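(* Let $(P,\rho,\bar\zeta)$ be an Eulerian quasi-graded poset with minimal element $\hat0$ and maximal element $\hat1$, $\hat0<\hat1$. Then its $\mathbf{ab}$-index $\Psi(P,\rho,\bar\zeta)$ can be written uniquely as a polynomial in the non-commutative variables $\mathbf c=\mathbf a+\mathbf b$ and $\mathbf d=\mathbf a\mathbf b+\mathbf b\mathbf a$. Furthermore, if $\bar\zeta$ is integer-valued, then this polynomial in $\mathbf c$ and $\mathbf d$ (the $\mathbf{cd}$-index) has only integer coefficients.
   Context: A quasi-graded poset $(P,\rho,\bar\zeta)$ consists of a finite poset $P$, a function $\rho:P\to\mathbb N$ with $x<y\Rightarrow\rho(x)<\rho(y)$, and a complex-valued function $\bar\zeta$ in the incidence algebra of $P$ with $\bar\zeta(x,x)=1$ for all $x$. Write $\rho(x,y)=\rho(y)-\rho(x)$. It is Eulerian if for all $x\le z$ $$\sum_{x\le y\le z}(-1)^{\rho(x,y)}\,\bar\zeta(x,y)\,\bar\zeta(y,z)=\delta_{x,z}.$$ If $P$ has a minimal element $\hat0$ and a maximal element $\hat1$ with $\hat0<\hat1$, its $\mathbf{ab}$-index is the polynomial in non-commuting variables $\mathbf a,\mathbf b$ $$\Psi(P,\rho,\bar\zeta)=\sum_{c}\bar\zeta(x_0,x_1)\cdots\bar\zeta(x_{k-1},x_k)\cdot(\mathbf a-\mathbf b)^{\rho(x_0,x_1)-1}\,\mathbf b\,(\mathbf a-\mathbf b)^{\rho(x_1,x_2)-1}\,\mathbf b\cdots\mathbf b\,(\mathbf a-\mathbf b)^{\rho(x_{k-1},x_k)-1},$$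 the sum being over all chains $c=\{\hat0=x_0<x_1<\cdots<x_k=\hat1\}$, $k\ge1$. *)

theory Defs
  imports Complex_Main "HOL-Library.Poly_Mapping"
begin

section \<open>Polynomials in non-commuting variables\<close>

text \<open>
  Words in the letters \<open>'a\<close> form the free monoid. With concatenation written additively,
  the multiplication on finitely supported functions from \<^theory>\<open>HOL-Library.Poly_Mapping\<close>
  is that of the free associative algebra, in which the scalars commute with the variables.
\<close>

datatype 'a nc_word = Word (letters: "'a list")

instantiation nc_word :: (type) monoid_add
begin

definition zero_nc_word :: "'a nc_word" where
  "0 = Word []"

definition plus_nc_word :: "'a nc_word \<Rightarrow> 'a nc_word \<Rightarrow> 'a nc_word" where
  "u + v = Word (letters u @ letters v)"

instance
  by standard (simp_all add: zero_nc_word_def plus_nc_word_def)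

end

type_synonym ('v, 'r) nc_poly = "'v nc_word \<Rightarrow>\<^sub>0 'r"

definition nc_const :: "'r \<Rightarrow> ('v, 'r::semiring_1) nc_poly" where
  "nc_const r = Poly_Mapping.single 0 r"

definition nc_var :: "'v \<Rightarrow> ('v, 'r::semiring_1) nc_poly" where
  "nc_var v = Poly_Mapping.single (Word [v]) 1"

definition nc_subst ::
    "('v \<Rightarrow> ('w, 'r) nc_poly) \<Rightarrow> ('v, 'r::semiring_1) nc_poly \<Rightarrow> ('w, 'r) nc_poly" where
  "nc_subst \<sigma> p =
     (\<Sum>w \<in> Poly_Mapping.keys p.
        nc_const (Poly_Mapping.lookup p w) * prod_list (map \<sigma> (letters w)))"

datatype ab = A | B

datatype cd = C | D

abbreviation a_poly :: "(ab, complex) nc_poly" where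
  "a_poly \<equiv> nc_var A"

abbreviation b_poly :: "(ab, complex) nc_poly" where
  "b_poly \<equiv> nc_var B"

fun cd_in_ab :: "cd \<Rightarrow> (ab, complex) nc_poly" where
  "cd_in_ab C = a_poly + b_poly"
| "cd_in_ab D = a_poly * b_poly + b_poly * a_poly"


section \<open>Quasi-graded posets\<close>

text \<open>
  A finite poset is a finite subset of an ordered type with the induced order. An element of
  the incidence algebra is a function of two arguments of which only the values at
  \<open>x \<le> y\<close> in \<open>P\<close> are ever used.
\<close>

definition quasi_graded ::
    "'p::order set \<Rightarrow> ('p \<Rightarrow> nat) \<Rightarrow> ('p \<Rightarrow> 'p \<Rightarrow> complex) \<Rightarrow> bool" where
  "quasi_graded P \<rho> \<zeta> \<longleftrightarrow>
     finite P \<and>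
     (\<forall>x\<in>P. \<forall>y\<in>P. x < y \<longrightarrow> \<rho> x < \<rho> y) \<and>
     (\<forall>x\<in>P. \<zeta> x x = 1)"

text \<open>Only used for \<open>x \<le> y\<close>, where the subtraction is not truncated.\<close>

definition rank_diff :: "('p \<Rightarrow> nat) \<Rightarrow> 'p \<Rightarrow> 'p \<Rightarrow> nat" where
  "rank_diff \<rho> x y = \<rho> y - \<rho> x"

definition eulerian ::
    "'p::order set \<Rightarrow> ('p \<Rightarrow> nat) \<Rightarrow> ('p \<Rightarrow> 'p \<Rightarrow> complex) \<Rightarrow> bool" where
  "eulerian P \<rho> \<zeta> \<longleftrightarrow>
     (\<forall>x\<in>P. \<forall>z\<in>P. x \<le> z \<longrightarrow>
        (\<Sum>y \<in> {y\<in>P. x \<le> y \<and> y \<le> z}. (-1) ^ rank_diff \<rho> x y * \<zeta> x y * \<zeta> y z)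
          = (if x = z then 1 else 0))"

definition is_least :: "'p::order set \<Rightarrow> 'p \<Rightarrow> bool" where
  "is_least P x \<longleftrightarrow> x \<in> P \<and> (\<forall>y\<in>P. x \<le> y)"

definition is_greatest :: "'p::order set \<Rightarrow> 'p \<Rightarrow> bool" where
  "is_greatest P x \<longleftrightarrow> x \<in> P \<and> (\<forall>y\<in>P. y \<le> x)"


section \<open>The ab-index\<close>

text \<open>A chain \<open>x\<^sub>0 < \<dots> < x\<^sub>k\<close> is the list \<open>[x\<^sub>0, \<dots>, x\<^sub>k]\<close>; if its ends differ, then \<open>k \<ge> 1\<close>.\<close>

definition chains_between :: "'p::order set \<Rightarrow> 'p \<Rightarrow> 'p \<Rightarrow> 'p list set" where
  "chains_between P x y =
     {xs. xs \<noteq> [] \<and> set xs \<subseteq> P \<and> sorted_wrt (<) xs \<and> hd xs = x \<and> last xs = y}"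

lemma finite_chains_between:
  assumes "finite P"
  shows "finite (chains_between P x y)"
proof (rule finite_subset)
  show "chains_between P x y \<subseteq> {xs. set xs \<subseteq> P \<and> length xs \<le> card P}"
  proof
    fix xs assume xs: "xs \<in> chains_between P x y"
    then have sub: "set xs \<subseteq> P" and "sorted_wrt (<) xs"
      by (auto simp: chains_between_def)
    then have "distinct xs"
      by (induction xs) auto
    then have "length xs \<le> card P"
      using card_mono[OF assms sub] by (simp add: distinct_card)
    with sub show "xs \<in> {xs. set xs \<subseteq> P \<and> length xs \<le> card P}"
      by simp
  qed
  show "finite {xs. set xs \<subseteq> P \<and> length xs \<le> card P}"
    by (rule finite_lists_length_le[OF assms])
qed

text \<open>The last equation is a dummy for lists with fewer than two entries.\<close>

fun chain_term ::
    "('p \<Rightarrow> nat) \<Rightarrow> ('p \<Rightarrow> 'p \<Rightarrow> complex) \<Rightarrow> 'p list \<Rightarrow> (ab, complex) nc_poly" where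
  "chain_term \<rho> \<zeta> [x, y] =
     nc_const (\<zeta> x y) * (a_poly - b_poly) ^ (rank_diff \<rho> x y - 1)"
| "chain_term \<rho> \<zeta> (x # y # z # zs) =
     nc_const (\<zeta> x y) * (a_poly - b_poly) ^ (rank_diff \<rho> x y - 1) * b_poly
       * chain_term \<rho> \<zeta> (y # z # zs)"
| "chain_term \<rho> \<zeta> _ = 0"

definition ab_index ::
    "'p::order set \<Rightarrow> ('p \<Rightarrow> nat) \<Rightarrow> ('p \<Rightarrow> 'p \<Rightarrow> complex) \<Rightarrow> 'p \<Rightarrow> 'p \<Rightarrow> (ab, complex) nc_poly"
  where
  "ab_index P \<rho> \<zeta> hat0 hat1 =
     (\<Sum>xs \<in> chains_between P hat0 hat1. chain_term \<rho> \<zeta> xs)"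

end

theory Submission
  imports Defs
begin

text \<open>
  Put \<open>e = a - b\<close>, so that \<open>e\<^sup>2 = c\<^sup>2 - 2d\<close> and \<open>b = (c - e) / 2\<close>. Let \<open>k\<close> be the strict part of
  \<open>\<zeta>\<close> and solve \<open>l + l k / 2 = k\<close> in the incidence algebra. Writing \<open>K = k e\<^sup>\<rho>\<^sup>-\<^sup>1\<close> and
  \<open>L = l e\<^sup>\<rho>\<^sup>-\<^sup>1\<close>, the recursion \<open>\<Psi> = K + K b \<Psi>\<close> turns into \<open>\<Psi> = L + L (c / 2) \<Psi>\<close>.
  The Eulerian relation says exactly that twisting \<open>k\<close> by \<open>(-1)\<^sup>\<rho>\<close> inverts \<open>1 + k\<close>, and
  since \<open>l = 2 k / (2 + k)\<close> this makes \<open>l\<close> vanish on intervals of even rank. Hence only even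
  powers of \<open>e\<close> occur in \<open>L\<close>, and \<open>\<Psi>\<close> is a polynomial in \<open>c\<close> and \<open>e\<^sup>2\<close>.

  The halves make this useless for integrality. Instead, the coefficients of a
  cd-polynomial are recovered from those of its ab-expansion by subtractions: if
  \<open>\<Phi> = \<phi> + c \<Phi>\<^sub>1 + d \<Phi>\<^sub>2\<close>, then the coefficient of \<open>u\<close> in \<open>\<Phi>\<^sub>2\<close> is the difference of those of
  \<open>abu\<close> and \<open>bbu\<close> in \<open>\<Phi>\<close>. This also gives uniqueness.
\<close>

section \<open>Non-commutative polynomials\<close>

lemma poly_mapping_sum_singles:
  fixes p :: "'k \<Rightarrow>\<^sub>0 'r::comm_monoid_add"
  shows "p = (\<Sum>k\<in>Poly_Mapping.keys p. Poly_Mapping.single k (Poly_Mapping.lookup p k))"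
proof (rule poly_mapping_eqI)
  fix k
  show "Poly_Mapping.lookup p k = Poly_Mapping.lookup
    (\<Sum>k\<in>Poly_Mapping.keys p. Poly_Mapping.single k (Poly_Mapping.lookup p k)) k"
    by (simp add: lookup_sum lookup_single when_def in_keys_iff)
qed

lemma poly_mapping_induct_single [case_names zero single add]:
  fixes p :: "'k \<Rightarrow>\<^sub>0 'r::comm_monoid_add"
  assumes "Q 0" and single: "\<And>k r. Q (Poly_Mapping.single k r)"
    and add: "\<And>p q. Q p \<Longrightarrow> Q q \<Longrightarrow> Q (p + q)"
  shows "Q p"
proof -
  have "Q (\<Sum>k\<in>S. Poly_Mapping.single k (Poly_Mapping.lookup p k))" for S
    by (induction S rule: infinite_finite_induct) (use assms in auto)
  then show ?thesis
    using poly_mapping_sum_singles[of p] by metis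
qed

lemma letters_0: "letters 0 = []"
  by (simp add: zero_nc_word_def)

lemma nc_const_0 [simp]: "nc_const 0 = 0"
  by (simp add: nc_const_def)

lemma nc_const_1 [simp]: "nc_const 1 = 1"
  by (simp add: nc_const_def)

lemma nc_const_add: "nc_const (r + s) = nc_const r + nc_const s"
  by (simp add: nc_const_def single_add)

lemma nc_const_mult: "nc_const (r * s) = nc_const r * nc_const s"
  by (simp add: nc_const_def mult_single)

lemma nc_const_sum: "nc_const (sum f S) = (\<Sum>x\<in>S. nc_const (f x))"
  by (induction S rule: infinite_finite_induct) (simp_all add: nc_const_add)

lemma nc_const_commute:
  fixes p :: "('v, 'r::comm_semiring_1) nc_poly"
  shows "p * nc_const r = nc_const r * p"
  by (induction p rule: poly_mapping_induct_single)
    (simp_all add: nc_const_def mult_single mult.commute algebra_simps)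

text \<open>Scalars are central, so they collect in front while the exponents of \<open>e\<close>
  add up. The order \<open>q * r * s\<close> is the one in which the factors 1/2,
  \<open>l x y\<close> and \<open>\<zeta> y z\<close> are summed later.\<close>

lemma nc_monomials_mult:
  fixes e :: "('v, complex) nc_poly"
  shows "nc_const r * e ^ m * (nc_const q * e) * (nc_const s * e ^ n) =
    nc_const (q * r * s) * e ^ Suc (m + n)"
proof -
  have "nc_const r * e ^ m * (nc_const q * e) * (nc_const s * e ^ n) =
      nc_const r * e ^ m * nc_const q * (e * nc_const s) * e ^ n"
    by (simp only: mult.assoc)
  also have "\<dots> = nc_const r * (e ^ m * nc_const (q * s)) * (e * e ^ n)"
    unfolding nc_const_commute[of e] nc_const_mult by (simp only: mult.assoc)
  also have "\<dots> = nc_const r * nc_const (q * s) * (e ^ m * (e * e ^ n))"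
    unfolding nc_const_commute[of "e ^ m"] by (simp only: mult.assoc)
  also have "e ^ m * (e * e ^ n) = e ^ Suc (m + n)"
    by (simp only: power_Suc[symmetric] power_add[symmetric] add_Suc_right)
  also have "nc_const r * nc_const (q * s) = nc_const (q * r * s)"
    by (simp only: nc_const_mult[symmetric] mult.left_commute[of r] mult.assoc)
  finally show ?thesis .
qed

lemma lookup_nc_const_mult:
  fixes p :: "('v, 'r::semiring_1) nc_poly"
  shows "Poly_Mapping.lookup (nc_const r * p) w = r * Poly_Mapping.lookup p w"
  by (induction p rule: poly_mapping_induct_single)
    (simp_all add: nc_const_def mult_single lookup_single lookup_add when_def distrib_left)

lemma lookup_nc_var_mult:
  fixes p :: "('v, 'r::semiring_1) nc_poly"
  shows "Poly_Mapping.lookup (nc_var v * p) (Word u) =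
    (case u of [] \<Rightarrow> 0 | x # u' \<Rightarrow> if x = v then Poly_Mapping.lookup p (Word u') else 0)"
proof (induction p rule: poly_mapping_induct_single)
  case zero
  then show ?case by (simp split: list.split)
next
  case (single k r)
  then show ?case
    by (cases k)
      (auto simp: nc_var_def mult_single lookup_single when_def plus_nc_word_def split: list.split)
next
  case (add p q)
  then show ?case by (simp add: distrib_left lookup_add split: list.split)
qed

section \<open>Substituting polynomials for variables\<close>

lemma nc_subst_superset:
  assumes "finite S" and "Poly_Mapping.keys p \<subseteq> S"
  shows "nc_subst \<sigma> p =
    (\<Sum>w\<in>S. nc_const (Poly_Mapping.lookup p w) * prod_list (map \<sigma> (letters w)))"
  unfolding nc_subst_def
  by (rule sum.mono_neutral_left) (use assms in \<open>auto simp: in_keys_iff\<close>)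

lemma nc_subst_0 [simp]: "nc_subst \<sigma> 0 = 0"
  by (simp add: nc_subst_def)

lemma nc_subst_add: "nc_subst \<sigma> (p + q) = nc_subst \<sigma> p + nc_subst \<sigma> q"
proof -
  let ?S = "Poly_Mapping.keys p \<union> Poly_Mapping.keys q"
  \<comment> \<open>Cancellation can shrink the support of \<open>p + q\<close>, so all three sums
    are taken over one common finite set.\<close>
  have "Poly_Mapping.keys (p + q) \<subseteq> ?S"
    by (rule keys_add)
  then show ?thesis
    by (simp add: nc_subst_superset[of ?S] lookup_add nc_const_add distrib_right sum.distrib)
qed

lemma nc_subst_uminus:
  fixes p :: "('v, 'r::ring_1) nc_poly"
  shows "nc_subst \<sigma> (- p) = - nc_subst \<sigma> p"
  using nc_subst_add[of \<sigma> p "- p"] by (simp add: eq_neg_iff_add_eq_0 add.commute)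

lemma nc_subst_diff:
  fixes p q :: "('v, 'r::ring_1) nc_poly"
  shows "nc_subst \<sigma> (p - q) = nc_subst \<sigma> p - nc_subst \<sigma> q"
  using nc_subst_add[of \<sigma> p "- q"] by (simp add: nc_subst_uminus)

lemma nc_subst_single:
  "nc_subst \<sigma> (Poly_Mapping.single w r) = nc_const r * prod_list (map \<sigma> (letters w))"
  by (simp add: nc_subst_superset[of "{w}"])

lemma nc_subst_1 [simp]: "nc_subst \<sigma> 1 = 1"
  unfolding single_one[symmetric] nc_subst_single
  by (simp add: letters_0)

lemma nc_subst_const_mult: "nc_subst \<sigma> (nc_const r * p) = nc_const r * nc_subst \<sigma> p"
  by (induction p rule: poly_mapping_induct_single)
    (simp_all add: nc_const_def mult_single nc_subst_single nc_subst_add distrib_left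
      flip: mult.assoc)

lemma nc_subst_var_mult:
  fixes \<sigma> :: "'v \<Rightarrow> ('w, 'r::comm_semiring_1) nc_poly"
  shows "nc_subst \<sigma> (nc_var v * p) = \<sigma> v * nc_subst \<sigma> p"
proof (induction p rule: poly_mapping_induct_single)
  case (single k r)
  then show ?case
    by (simp add: nc_var_def mult_single nc_subst_single plus_nc_word_def nc_const_commute
        flip: mult.assoc)
qed (simp_all add: nc_subst_add distrib_left)

section \<open>Polynomials with integer coefficients\<close>

definition int_coeffs :: "('v, complex) nc_poly \<Rightarrow> bool" where
  "int_coeffs p \<longleftrightarrow> (\<forall>w. Poly_Mapping.lookup p w \<in> \<int>)"

lemma int_coeffs_single: "r \<in> \<int> \<Longrightarrow> int_coeffs (Poly_Mapping.single w r)"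
  by (simp add: int_coeffs_def lookup_single when_def)

lemma int_coeffs_sum: "(\<And>x. x \<in> S \<Longrightarrow> int_coeffs (f x)) \<Longrightarrow> int_coeffs (sum f S)"
  by (auto simp: int_coeffs_def lookup_sum)

lemma int_coeffs_diff: "int_coeffs p \<Longrightarrow> int_coeffs q \<Longrightarrow> int_coeffs (p - q)"
  by (auto simp: int_coeffs_def lookup_minus)

lemma int_coeffs_mult:
  assumes "int_coeffs p" and "int_coeffs q"
  shows "int_coeffs (p * q)"
proof -
  have "p * q = (\<Sum>k\<in>Poly_Mapping.keys p. \<Sum>l\<in>Poly_Mapping.keys q.
      Poly_Mapping.single (k + l) (Poly_Mapping.lookup p k * Poly_Mapping.lookup q l))"
    using arg_cong2[OF poly_mapping_sum_singles[of p] poly_mapping_sum_singles[of q], of "(*)"]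
    by (simp only: sum_product mult_single)
  also have "int_coeffs \<dots>"
    by (intro int_coeffs_sum int_coeffs_single Ints_mult) (use assms in \<open>simp_all add: int_coeffs_def\<close>)
  finally show ?thesis .
qed

lemma int_coeffs_power: "int_coeffs p \<Longrightarrow> int_coeffs (p ^ n)"
  by (induction n)
    (simp_all add: int_coeffs_mult int_coeffs_single flip: single_one)

lemma int_coeffs_const: "r \<in> \<int> \<Longrightarrow> int_coeffs (nc_const r)"
  by (simp add: nc_const_def int_coeffs_single)

lemma int_coeffs_var: "int_coeffs (nc_var v)"
  by (simp add: nc_var_def int_coeffs_single)


section \<open>Recovering the coefficients of a cd-polynomial\<close>

text \<open>The coefficient of an ab-word in the expansion of the cd-polynomial with coefficients \<open>f\<close>.\<close>

fun cd_expand :: "(cd list \<Rightarrow> complex) \<Rightarrow> ab list \<Rightarrow> complex" where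
  "cd_expand f [] = f []"
| "cd_expand f [x] = f [C]"
| "cd_expand f (x # y # u) = cd_expand (\<lambda>w. f (C # w)) (y # u) +
     (if x = y then 0 else cd_expand (\<lambda>w. f (D # w)) u)"

lemma cd_expand_0: "cd_expand (\<lambda>w. 0) u = 0"
  by (induction "\<lambda>w::cd list. 0::complex" u rule: cd_expand.induct) auto

lemma cd_expand_add: "cd_expand (\<lambda>w. f w + g w) u = cd_expand f u + cd_expand g u"
  by (induction f u arbitrary: g rule: cd_expand.induct) auto

lemma cd_expand_mult: "cd_expand (\<lambda>w. r * f w) u = r * cd_expand f u"
  by (induction f u rule: cd_expand.induct) (auto simp: distrib_left)

text \<open>A leading c accounts for either first letter, so it just removes one letter; a leading d
  accounts only for the prefixes ab and ba, so it removes two distinct letters. These are the two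
  summands in \<open>cd_expand\<close>.\<close>

lemma lookup_cd_word:
  "Poly_Mapping.lookup (prod_list (map cd_in_ab ws)) (Word u) =
    cd_expand (\<lambda>w. if w = ws then 1 else 0) u"
proof (induction ws arbitrary: u)
  case Nil
  have "cd_expand (\<lambda>w. if w = [] then 1 else 0) u = (if u = [] then 1 else 0)"
    \<comment> \<open>This rule separates words of length 0, 1 and at least 2, as the equations of
      \<open>cd_expand\<close> do.\<close>
    by (cases u rule: remdups_adj.cases)
      (auto simp: cd_expand_0)
  then show ?case
    by (simp add: lookup_one zero_nc_word_def when_def)
next
  case (Cons t ws)
  show ?case
  proof (cases t)
    case C
    have "Poly_Mapping.lookup (prod_list (map cd_in_ab (t # ws))) (Word u) =
        (case u of [] \<Rightarrow> 0 | x # u' \<Rightarrow> Poly_Mapping.lookup (prod_list (map cd_in_ab ws)) (Word u'))"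
      by (cases u; cases "hd u") (simp_all add: C distrib_right lookup_add lookup_nc_var_mult)
    also have "\<dots> = cd_expand (\<lambda>w. if w = t # ws then 1 else 0) u"
      by (cases u rule: remdups_adj.cases)
        (auto simp: C Cons.IH cd_expand_0)
    finally show ?thesis .
  next
    case D
    have "Poly_Mapping.lookup (prod_list (map cd_in_ab (t # ws))) (Word u) =
        (case u of [] \<Rightarrow> 0 | [x] \<Rightarrow> 0 | x # y # u' \<Rightarrow>
          if x = y then 0 else Poly_Mapping.lookup (prod_list (map cd_in_ab ws)) (Word u'))"
      by (cases u rule: remdups_adj.cases; cases "hd u"; cases "hd (tl u)")
        (simp_all add: D distrib_right lookup_add lookup_nc_var_mult mult.assoc)
    also have "\<dots> = cd_expand (\<lambda>w. if w = t # ws then 1 else 0) u"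
      by (cases u rule: remdups_adj.cases)
        (auto simp: D Cons.IH cd_expand_0)
    finally show ?thesis .
  qed
qed

lemma lookup_nc_subst_cd:
  "Poly_Mapping.lookup (nc_subst cd_in_ab \<Phi>) (Word u) =
    cd_expand (\<lambda>w. Poly_Mapping.lookup \<Phi> (Word w)) u"
proof (induction \<Phi> rule: poly_mapping_induct_single)
  case zero
  then show ?case by (simp add: cd_expand_0)
next
  case (single k r)
  obtain ws where "k = Word ws" by (cases k)
  then have "Poly_Mapping.lookup (nc_subst cd_in_ab (Poly_Mapping.single k r)) (Word u) =
      cd_expand (\<lambda>w. r * (if w = ws then 1 else 0)) u"
    by (simp only: nc_subst_single lookup_nc_const_mult nc_word.sel lookup_cd_word cd_expand_mult)
  also have "(\<lambda>w. r * (if w = ws then 1 else 0)) =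
      (\<lambda>w. Poly_Mapping.lookup (Poly_Mapping.single k r) (Word w))"
    using \<open>k = Word ws\<close> by (auto simp: lookup_single when_def)
  finally show ?case .
next
  case (add p q)
  then show ?case by (simp add: nc_subst_add lookup_add cd_expand_add)
qed

text \<open>Only subtraction is used to recover coefficients, so one induction serves twice:
  \<open>G = {0}\<close> gives uniqueness and \<open>G = \<int>\<close> gives integrality.\<close>

lemma cd_coeff_in_subgroup:
  assumes diff: "\<And>r s. r \<in> G \<Longrightarrow> s \<in> G \<Longrightarrow> r - s \<in> G"
    and "\<And>u. cd_expand f u \<in> G"
  shows "f w \<in> G"
  using assms(2)
proof (induction w arbitrary: f)
  case Nil
  from Nil[of "[]"] show ?case by simp
next
  case (Cons t w)
  \<comment> \<open>The words abu and bbu have the same c-part, read off at bu, and only the first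
    has a d-part.\<close>
  have d_part: "cd_expand (\<lambda>w. f (D # w)) u \<in> G" for u
    using diff[OF Cons.prems[of "A # B # u"] Cons.prems[of "B # B # u"]] by simp
  show ?case
  proof (cases t)
    case D
    then show ?thesis using Cons.IH[OF d_part] by simp
  next
    case C
    \<comment> \<open>Doubling the first letter of \<open>u\<close> suppresses the d-part; for empty
      \<open>u\<close> a one-letter word does the same.\<close>
    have "cd_expand (\<lambda>w. f (C # w)) u \<in> G" for u
    proof (cases u)
      case Nil
      then show ?thesis using Cons.prems[of "[A]"] by simp
    next
      case (Cons x u')
      then show ?thesis using Cons.prems[of "x # x # u'"] by simp
    qed
    then show ?thesis using C Cons.IH[of "\<lambda>w. f (C # w)"] by simp
  qed
qed

lemma cd_lookup_in_subgroup:
  assumes "\<And>r s. r \<in> G \<Longrightarrow> s \<in> G \<Longrightarrow> r - s \<in> G"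
    and "\<And>u. Poly_Mapping.lookup (nc_subst cd_in_ab \<Phi>) u \<in> G"
  shows "Poly_Mapping.lookup \<Phi> w \<in> G"
proof -
  have "cd_expand (\<lambda>w. Poly_Mapping.lookup \<Phi> (Word w)) u \<in> G" for u
    using assms(2)[of "Word u"] by (simp add: lookup_nc_subst_cd)
  from cd_coeff_in_subgroup[of G, OF assms(1) this] show ?thesis
    by (cases w) auto
qed

lemma nc_subst_cd_inj:
  assumes "nc_subst cd_in_ab \<Phi> = nc_subst cd_in_ab \<Phi>'"
  shows "\<Phi> = \<Phi>'"
proof (rule poly_mapping_eqI)
  fix w
  have "Poly_Mapping.lookup (\<Phi> - \<Phi>') w \<in> {0}"
    by (rule cd_lookup_in_subgroup) (auto simp: nc_subst_diff assms)
  then show "Poly_Mapping.lookup \<Phi> w = Poly_Mapping.lookup \<Phi>' w"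
    by (simp add: lookup_minus)
qed


section \<open>Strict convolution\<close>

text \<open>The incidence-algebra product of strict parts, with diagonal terms left out. The values
  may be complex numbers or non-commutative polynomials, so the order of factors matters.\<close>

definition conv ::
    "'p::order set \<Rightarrow> ('p \<Rightarrow> 'p \<Rightarrow> 'r) \<Rightarrow> ('p \<Rightarrow> 'p \<Rightarrow> 'r) \<Rightarrow> 'p \<Rightarrow> 'p \<Rightarrow> 'r::semiring_0" where
  "conv P f g x z = (\<Sum>y\<in>{y\<in>P. x < y \<and> y < z}. f x y * g y z)"

lemma conv_assoc:
  assumes "finite P"
  shows "conv P (conv P f g) h x z = conv P f (conv P g h) x z"
proof -
  let ?I = "{y\<in>P. x < y \<and> y < z}"
  have "conv P (conv P f g) h x z =
      (\<Sum>y\<in>?I. \<Sum>w\<in>{w\<in>P. x < w \<and> w < y}. f x w * (g w y * h y z))"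
    by (simp add: conv_def sum_distrib_right mult.assoc)
  \<comment> \<open>Placing \<open>w\<close> in the same interval as \<open>y\<close> lets the two
    sums be exchanged.\<close>
  also have "\<dots> = (\<Sum>y\<in>?I. \<Sum>w\<in>{w\<in>?I. w < y}. f x w * (g w y * h y z))"
    by (intro sum.cong) (auto intro: less_trans)
  also have "\<dots> = (\<Sum>w\<in>?I. \<Sum>y\<in>{y\<in>?I. w < y}. f x w * (g w y * h y z))"
    by (rule sum.swap_restrict) (use assms in auto)
  also have "\<dots> = (\<Sum>w\<in>?I. \<Sum>y\<in>{y\<in>P. w < y \<and> y < z}. f x w * (g w y * h y z))"
    by (intro sum.cong) (auto intro: less_trans)
  also have "\<dots> = conv P f (conv P g h) x z"
    by (simp add: conv_def sum_distrib_left)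
  finally show ?thesis .
qed

lemma conv_cong:
  assumes "\<And>y. y \<in> P \<Longrightarrow> x < y \<Longrightarrow> y < z \<Longrightarrow> f x y = f' x y"
    and "\<And>y. y \<in> P \<Longrightarrow> x < y \<Longrightarrow> y < z \<Longrightarrow> g y z = g' y z"
  shows "conv P f g x z = conv P f' g' x z"
  unfolding conv_def by (rule sum.cong) (use assms in auto)

lemma conv_add_right: "conv P f (\<lambda>x y. g x y + h x y) x z = conv P f g x z + conv P f h x z"
  by (simp add: conv_def distrib_left sum.distrib)

lemma conv_diff_left:
  fixes f :: "'p::order \<Rightarrow> 'p \<Rightarrow> 'r::ring"
  shows "conv P (\<lambda>x y. f x y - g x y) h x z = conv P f h x z - conv P g h x z"
  by (simp add: conv_def left_diff_distrib sum_subtractf)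

lemma conv_scale_left: "conv P (\<lambda>x y. r * f x y) g x z = r * conv P f g x z"
  by (simp add: conv_def sum_distrib_left mult.assoc)

text \<open>The right-hand side at \<open>z\<close> involves \<open>f x\<close> only at elements of
  smaller rank, so induction on rank leaves nothing but zero. Applied to the defect of an identity,
  this proves the identity.\<close>

lemma conv_fixpoint_zero:
  fixes r :: "'r::ring" and \<rho> :: "'p::order \<Rightarrow> nat"
  assumes mono: "\<And>y z. y \<in> P \<Longrightarrow> z \<in> P \<Longrightarrow> y < z \<Longrightarrow> \<rho> y < \<rho> z"
    and fixpoint: "\<And>z. z \<in> P \<Longrightarrow> x < z \<Longrightarrow> f x z = r * conv P f g x z"
    and "z \<in> P" "x < z"
  shows "f x z = 0"
  using \<open>z \<in> P\<close> \<open>x < z\<close>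
proof (induction "\<rho> z" arbitrary: z rule: less_induct)
  case less
  have "conv P f g x z = 0"
    unfolding conv_def by (rule sum.neutral) (use less mono in auto)
  then show ?case using fixpoint less.prems by simp
qed


section \<open>The symmetrized zeta function\<close>

text \<open>
  The solution of \<open>l + l \<zeta> / 2 = \<zeta>\<close> for strict convolution. The condition \<open>\<rho> y < \<rho> z\<close> is redundant
  in a quasi-graded poset; it makes the recursion terminate for all arguments.
\<close>

function sym_zeta ::
    "'p::order set \<Rightarrow> ('p \<Rightarrow> nat) \<Rightarrow> ('p \<Rightarrow> 'p \<Rightarrow> complex) \<Rightarrow> 'p \<Rightarrow> 'p \<Rightarrow> complex" where
  "sym_zeta P \<rho> \<zeta> x z =
     \<zeta> x z - 1 / 2 * (\<Sum>y\<in>{y\<in>P. x < y \<and> y < z \<and> \<rho> y < \<rho> z}. sym_zeta P \<rho> \<zeta> x y * \<zeta> y z)"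
  by pat_completeness auto
termination
  by (relation "measure (\<lambda>(P, \<rho>, \<zeta>, x, z). \<rho> z)") auto

declare sym_zeta.simps [simp del]

locale quasi_graded_poset =
  fixes P :: "'p::order set" and \<rho> :: "'p \<Rightarrow> nat" and \<zeta> :: "'p \<Rightarrow> 'p \<Rightarrow> complex"
  assumes quasi_graded: "quasi_graded P \<rho> \<zeta>"
begin

lemma finite_P: "finite P"
  and rank_mono: "x \<in> P \<Longrightarrow> y \<in> P \<Longrightarrow> x < y \<Longrightarrow> \<rho> x < \<rho> y"
  and zeta_refl: "x \<in> P \<Longrightarrow> \<zeta> x x = 1"
  using quasi_graded by (auto simp: quasi_graded_def)

lemma rank_diff_split:
  assumes "x \<in> P" "y \<in> P" "z \<in> P" "x < y" "y < z"
  shows "rank_diff \<rho> x z = rank_diff \<rho> x y + rank_diff \<rho> y z"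
    and "0 < rank_diff \<rho> x y" and "0 < rank_diff \<rho> y z"
  using rank_mono[of x y] rank_mono[of y z] assms by (simp_all add: rank_diff_def)

abbreviation (input) "l \<equiv> sym_zeta P \<rho> \<zeta>"

lemma sym_zeta_eq:
  assumes "z \<in> P"
  shows "l x z = \<zeta> x z - 1 / 2 * conv P l \<zeta> x z"
proof -
  have "{y\<in>P. x < y \<and> y < z \<and> \<rho> y < \<rho> z} = {y\<in>P. x < y \<and> y < z}"
    using assms rank_mono by auto
  then show ?thesis
    by (subst sym_zeta.simps) (simp add: conv_def)
qed

text \<open>The sign is chosen so that, with \<open>k\<close> the strict part of
  \<open>\<zeta>\<close>, the Eulerian relation reads \<open>(1 - j) (1 + k) = 1\<close>.\<close>

definition twisted_zeta :: "'p \<Rightarrow> 'p \<Rightarrow> complex" where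
  "twisted_zeta x y = - ((-1) ^ rank_diff \<rho> x y * \<zeta> x y)"

abbreviation (input) "j \<equiv> twisted_zeta"

lemma eulerian_twisted_zeta:
  assumes "eulerian P \<rho> \<zeta>" "x \<in> P" "z \<in> P" "x < z"
  shows "\<zeta> x z = j x z + conv P j \<zeta> x z"
proof -
  \<comment> \<open>The endpoint \<open>y = x\<close> contributes \<open>\<zeta> x z\<close> and
    \<open>y = z\<close> contributes \<open>- j x z\<close>; the interior gives the
    convolution.\<close>
  have S: "{y\<in>P. x \<le> y \<and> y \<le> z} = insert x (insert z {y\<in>P. x < y \<and> y < z})"
    using assms by auto
  have "(\<Sum>y \<in> {y\<in>P. x \<le> y \<and> y \<le> z}. (-1) ^ rank_diff \<rho> x y * \<zeta> x y * \<zeta> y z) = 0"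
    using assms by (auto simp: eulerian_def)
  also have "(\<Sum>y \<in> {y\<in>P. x \<le> y \<and> y \<le> z}. (-1) ^ rank_diff \<rho> x y * \<zeta> x y * \<zeta> y z) =
      \<zeta> x z - j x z - conv P j \<zeta> x z"
    unfolding S using assms finite_P
    by (simp add: zeta_refl rank_diff_def twisted_zeta_def conv_def sum_negf)
  finally show ?thesis by (simp add: algebra_simps)
qed

text \<open>Formally \<open>l = k / (1 + k/2)\<close> and \<open>j = k / (1 + k)\<close>, hence
  \<open>l = j / (1 - j/2)\<close>. The proof shows that the defect \<open>X\<close> satisfies
  \<open>X (1 + k) = 0\<close>.\<close>

lemma sym_zeta_eq_twisted:
  assumes "eulerian P \<rho> \<zeta>" "x \<in> P" "z \<in> P" "x < z"
  shows "l x z = j x z + 1 / 2 * conv P l j x z"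
proof -
  define X where "X x z = l x z - j x z - 1 / 2 * conv P l j x z" for x z
  have "X x z = - 1 * conv P X \<zeta> x z" if z: "z \<in> P" "x < z" for z
  proof -
    have "conv P (conv P l j) \<zeta> x z = conv P l (conv P j \<zeta>) x z"
      by (rule conv_assoc[OF finite_P])
    also have "\<dots> = conv P l (\<lambda>x y. \<zeta> x y + (-1) * j x y) x z"
      by (rule conv_cong) (use assms z eulerian_twisted_zeta in \<open>auto simp: algebra_simps\<close>)
    also have "\<dots> = conv P l \<zeta> x z - conv P l j x z"
      by (simp add: conv_def sum_subtractf right_diff_distrib)
    finally have assoc: "conv P (conv P l j) \<zeta> x z = conv P l \<zeta> x z - conv P l j x z" .
    have "conv P X \<zeta> x z =
        conv P l \<zeta> x z - conv P j \<zeta> x z - 1 / 2 * (conv P l \<zeta> x z - conv P l j x z)"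
      unfolding X_def conv_diff_left conv_scale_left assoc ..
    moreover have "X x z = l x z - j x z - 1 / 2 * conv P l j x z"
      by (simp add: X_def)
    moreover have "l x z = j x z + conv P j \<zeta> x z - 1 / 2 * conv P l \<zeta> x z"
      unfolding sym_zeta_eq[OF z(1), of x] eulerian_twisted_zeta[OF assms(1,2) z] ..
    ultimately show ?thesis
      by (simp only:) (simp add: field_simps)
  qed
  from conv_fixpoint_zero[of P \<rho> x X "-1" \<zeta> z, OF rank_mono this] assms
  have "X x z = 0" by auto
  then show ?thesis by (simp add: X_def algebra_simps)
qed

text \<open>Ranks add along chains, so twisting by the sign of the rank difference is
  multiplicative. It sends \<open>k\<close> to \<open>- j\<close>, and hence the equation defining
  \<open>l\<close> to \<open>s = j + s j / 2\<close>, which \<open>l\<close> also solves. Thus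
  \<open>l = s\<close>, while \<open>s = - l\<close> on even rank.\<close>

lemma sym_zeta_even_rank:
  assumes "eulerian P \<rho> \<zeta>" "x \<in> P" "z \<in> P" "x < z" "even (rank_diff \<rho> x z)"
  shows "l x z = 0"
proof -
  define s where "s x z = - ((-1) ^ rank_diff \<rho> x z * l x z)" for x z
  define X where "X x z = l x z - s x z" for x z
  have "X x z = 1 / 2 * conv P X j x z" if z: "z \<in> P" "x < z" for z
  proof -
    have "(-1) ^ rank_diff \<rho> x z * conv P l \<zeta> x z = conv P s j x z"
      unfolding conv_def sum_distrib_left
    proof (rule sum.cong[OF refl])
      fix y assume "y \<in> {y\<in>P. x < y \<and> y < z}"
      then have "rank_diff \<rho> x z = rank_diff \<rho> x y + rank_diff \<rho> y z"
        using rank_diff_split(1)[of x y z] assms z by auto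
      then show "(-1) ^ rank_diff \<rho> x z * (l x y * \<zeta> y z) = s x y * j y z"
        by (simp add: s_def twisted_zeta_def power_add)
    qed
    moreover have "s x z = j x z + 1 / 2 * ((-1) ^ rank_diff \<rho> x z * conv P l \<zeta> x z)"
      unfolding s_def twisted_zeta_def sym_zeta_eq[OF z(1), of x] by (simp add: algebra_simps)
    ultimately have "s x z = j x z + 1 / 2 * conv P s j x z"
      by simp
    moreover have "l x z = j x z + 1 / 2 * conv P l j x z"
      by (rule sym_zeta_eq_twisted) (use assms z in auto)
    ultimately show ?thesis
      unfolding X_def conv_diff_left by (simp add: algebra_simps)
  qed
  from conv_fixpoint_zero[of P \<rho> x X "1 / 2" j z, OF rank_mono this] assms
  have "X x z = 0" by auto
  then show ?thesis using assms(5) by (simp add: X_def s_def)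
qed


section \<open>Recursions for the ab-index\<close>

lemma chains_between_rec:
  assumes "x \<in> P" "z \<in> P" "x < z"
  shows "chains_between P x z =
    insert [x, z] (\<Union>y\<in>{y\<in>P. x < y \<and> y < z}. (#) x ` chains_between P y z)"
    (is "_ = ?R")
proof (intro set_eqI iffI)
  fix xs assume xs: "xs \<in> chains_between P x z"
  then obtain ys where ys: "xs = x # ys" "ys \<noteq> []"
    using assms(3) by (cases xs) (auto simp: chains_between_def split: if_splits)
  then obtain y zs where y: "ys = y # zs" by (cases ys) auto
  from xs have ch: "ys \<in> chains_between P y z" "x < y" "y \<in> P"
    by (auto simp: chains_between_def ys y)
  show "xs \<in> ?R"
  proof (cases "zs = []")
    case True
    then show ?thesis using xs by (auto simp: chains_between_def ys y)
  next
    case False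
    then have "z \<in> set zs" using xs by (auto simp: chains_between_def ys y)
    then have "y < z" using xs by (auto simp: chains_between_def ys y)
    then show ?thesis using ch by (auto simp: ys)
  qed
next
  fix xs assume "xs \<in> ?R"
  then show "xs \<in> chains_between P x z"
  proof
    assume "xs = [x, z]"
    then show ?thesis using assms by (auto simp: chains_between_def)
  next
    assume "xs \<in> (\<Union>y\<in>{y\<in>P. x < y \<and> y < z}. (#) x ` chains_between P y z)"
    then obtain y ys where y: "x < y" and ys: "ys \<in> chains_between P y z" "xs = x # ys"
      by auto
    then obtain zs where "ys = y # zs" by (cases ys) (auto simp: chains_between_def)
    then show ?thesis using y ys assms by (auto simp: chains_between_def intro: less_trans)
  qed
qed

definition chain_step :: "'p \<Rightarrow> 'p \<Rightarrow> (ab, complex) nc_poly" where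
  "chain_step x y = nc_const (\<zeta> x y) * (a_poly - b_poly) ^ (rank_diff \<rho> x y - 1)"

abbreviation (input) "\<Psi> \<equiv> ab_index P \<rho> \<zeta>"

text \<open>As \<open>y < z\<close>, the list \<open>ys\<close> has at least two entries, which
  keeps the dummy equation of \<open>chain_term\<close> out of play.\<close>

lemma chain_term_Cons:
  assumes "ys \<in> chains_between P y z" "y < z"
  shows "chain_term \<rho> \<zeta> (x # ys) = chain_step x y * b_poly * chain_term \<rho> \<zeta> ys"
proof -
  obtain zs where "ys = y # zs"
    using assms by (cases ys) (auto simp: chains_between_def)
  moreover obtain w ws where "zs = w # ws"
    using assms calculation by (cases zs) (auto simp: chains_between_def)
  ultimately show ?thesis by (simp add: chain_step_def mult.assoc)
qed

lemma ab_index_rec: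
  assumes "x \<in> P" "z \<in> P" "x < z"
  shows "\<Psi> x z = chain_step x z + conv P chain_step (\<lambda>y z. b_poly * \<Psi> y z) x z"
proof -
  let ?S = "{y\<in>P. x < y \<and> y < z}"
  let ?U = "\<Union>y\<in>?S. (#) x ` chains_between P y z"
  have fin: "finite ?S" "\<And>y. finite (chains_between P y z)"
    using finite_P finite_chains_between by auto
  have notin: "[x, z] \<notin> ?U"
    by (auto simp: chains_between_def)
  have "\<Psi> x z = chain_term \<rho> \<zeta> [x, z] + (\<Sum>xs\<in>?U. chain_term \<rho> \<zeta> xs)"
    unfolding ab_index_def chains_between_rec[OF assms]
    by (subst sum.insert) (use fin notin in auto)
  also have "(\<Sum>xs\<in>?U. chain_term \<rho> \<zeta> xs) =
      (\<Sum>y\<in>?S. \<Sum>xs\<in>(#) x ` chains_between P y z. chain_term \<rho> \<zeta> xs)"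
    by (rule sum.UNION_disjoint) (use fin in \<open>auto simp: chains_between_def\<close>)
  also have "\<dots> = (\<Sum>y\<in>?S. chain_step x y * (b_poly * \<Psi> y z))"
    by (rule sum.cong)
      (auto simp: sum.reindex chain_term_Cons ab_index_def sum_distrib_left mult.assoc
        intro!: sum.cong)
  finally show ?thesis by (simp add: conv_def chain_step_def)
qed

section \<open>Trading b for c and powers of a - b\<close>

definition sym_step :: "'p \<Rightarrow> 'p \<Rightarrow> (ab, complex) nc_poly" where
  "sym_step x y = nc_const (l x y) * (a_poly - b_poly) ^ (rank_diff \<rho> x y - 1)"

abbreviation (input) half_e :: "(ab, complex) nc_poly" where
  "half_e \<equiv> nc_const (1 / 2) * (a_poly - b_poly)"

text \<open>This is \<open>l + l k / 2 = k\<close> with powers of e = a - b attached. Two exponents,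
  each one below a positive rank difference, sum to one less than required; \<open>half_e\<close>
  supplies the missing factor e.\<close>

lemma sym_step_conv_chain_step:
  assumes "x \<in> P" "z \<in> P" "x < z"
  shows "conv P (\<lambda>x y. sym_step x y * half_e) chain_step x z = chain_step x z - sym_step x z"
proof -
  let ?S = "{y\<in>P. x < y \<and> y < z}"
  let ?e = "a_poly - b_poly :: (ab, complex) nc_poly"
  have "sym_step x y * half_e * chain_step y z =
      nc_const (1 / 2 * l x y * \<zeta> y z) * ?e ^ (rank_diff \<rho> x z - 1)" if "y \<in> ?S" for y
  proof -
    have "rank_diff \<rho> x z - 1 = Suc ((rank_diff \<rho> x y - 1) + (rank_diff \<rho> y z - 1))"
      using rank_diff_split[of x y z] that assms by auto
    then show ?thesis
      by (simp only: sym_step_def chain_step_def nc_monomials_mult)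
  qed
  then have "conv P (\<lambda>x y. sym_step x y * half_e) chain_step x z =
      nc_const (1 / 2 * conv P l \<zeta> x z) * ?e ^ (rank_diff \<rho> x z - 1)"
    by (simp add: conv_def sum_distrib_left sum_distrib_right nc_const_sum mult.assoc)
  moreover have "(nc_const (\<zeta> x z) :: (ab, complex) nc_poly) =
      nc_const (l x z) + nc_const (1 / 2 * conv P l \<zeta> x z)"
    using sym_zeta_eq[OF assms(2), of x] by (simp flip: nc_const_add)
  then have "chain_step x z =
      sym_step x z + nc_const (1 / 2 * conv P l \<zeta> x z) * ?e ^ (rank_diff \<rho> x z - 1)"
    by (simp only: chain_step_def sym_step_def distrib_right)
  ultimately show ?thesis by simp
qed

lemma half_c_eq: "nc_const (1 / 2) * (a_poly + b_poly) = b_poly + half_e"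
proof -
  have "b_poly = nc_const (1 / 2 + 1 / 2) * b_poly"
    by simp
  then have "b_poly = nc_const (1 / 2) * b_poly + nc_const (1 / 2) * b_poly"
    by (simp only: nc_const_add distrib_right)
  then show ?thesis by (simp add: algebra_simps)
qed

text \<open>Write c/2 = b + e/2 and insert \<open>\<Psi> = K + K b \<Psi>\<close> into
  \<open>L (e/2) \<Psi>\<close>. Since \<open>L (e/2) K = K - L\<close>, the terms
  \<open>L b \<Psi>\<close> cancel and \<open>\<Psi> - L\<close> remains.\<close>

lemma ab_index_sym_rec:
  assumes "x \<in> P" "z \<in> P" "x < z"
  shows "\<Psi> x z = sym_step x z +
    conv P sym_step (\<lambda>y z. nc_const (1 / 2) * (a_poly + b_poly) * \<Psi> y z) x z"
proof -
  let ?K = chain_step and ?L = sym_step and ?b\<Psi> = "\<lambda>y z. b_poly * \<Psi> y z"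
  let ?Le = "\<lambda>x y. sym_step x y * half_e"
  have "conv P ?L (\<lambda>y z. nc_const (1 / 2) * (a_poly + b_poly) * \<Psi> y z) x z =
      conv P ?L ?b\<Psi> x z + conv P ?Le \<Psi> x z"
    unfolding half_c_eq
    by (simp only: conv_def distrib_right distrib_left sum.distrib mult.assoc)
  also have "conv P ?Le \<Psi> x z = conv P ?Le (\<lambda>x z. ?K x z + conv P ?K ?b\<Psi> x z) x z"
    by (rule conv_cong) (use assms ab_index_rec in auto)
  also have "\<dots> = conv P ?Le ?K x z + conv P (conv P ?Le ?K) ?b\<Psi> x z"
    by (simp only: conv_add_right conv_assoc[OF finite_P])
  also have "conv P (conv P ?Le ?K) ?b\<Psi> x z = conv P (\<lambda>x z. ?K x z - ?L x z) ?b\<Psi> x z"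
    by (rule conv_cong) (use assms sym_step_conv_chain_step in auto)
  also have "\<dots> = conv P ?K ?b\<Psi> x z - conv P ?L ?b\<Psi> x z"
    by (rule conv_diff_left)
  finally show ?thesis
    using ab_index_rec[OF assms] sym_step_conv_chain_step[OF assms] by simp
qed


section \<open>Existence and integrality of the cd-index\<close>

abbreviation cd_polys :: "(ab, complex) nc_poly set" where
  "cd_polys \<equiv> range (nc_subst cd_in_ab)"

lemma cd_polys_add: "p \<in> cd_polys \<Longrightarrow> q \<in> cd_polys \<Longrightarrow> p + q \<in> cd_polys"
  by (auto simp flip: nc_subst_add)

lemma cd_polys_diff: "p \<in> cd_polys \<Longrightarrow> q \<in> cd_polys \<Longrightarrow> p - q \<in> cd_polys"
  by (auto simp flip: nc_subst_diff)

lemma cd_polys_0: "0 \<in> cd_polys"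
  using nc_subst_0 by (metis rangeI)

lemma cd_polys_sum: "(\<And>x. x \<in> S \<Longrightarrow> f x \<in> cd_polys) \<Longrightarrow> sum f S \<in> cd_polys"
  by (induction S rule: infinite_finite_induct) (auto intro: cd_polys_0 cd_polys_add)

lemma cd_polys_const_mult: "p \<in> cd_polys \<Longrightarrow> nc_const r * p \<in> cd_polys"
  by (auto simp flip: nc_subst_const_mult)

lemma cd_polys_var_mult: "p \<in> cd_polys \<Longrightarrow> cd_in_ab t * p \<in> cd_polys"
  by (auto simp flip: nc_subst_var_mult)

lemma e_square: "(a_poly - b_poly) * (a_poly - b_poly) * p =
    cd_in_ab C * (cd_in_ab C * p) - (cd_in_ab D * p + cd_in_ab D * p)"
  by (simp add: algebra_simps)

lemma cd_polys_even_power_mult: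
  "p \<in> cd_polys \<Longrightarrow> (a_poly - b_poly) ^ (2 * m) * p \<in> cd_polys"
proof (induction m)
  case (Suc m)
  have "(a_poly - b_poly) ^ (2 * Suc m) * p =
      (a_poly - b_poly) * (a_poly - b_poly) * ((a_poly - b_poly) ^ (2 * m) * p)"
    by (simp add: mult.assoc)
  also have "\<dots> \<in> cd_polys"
    unfolding e_square by (intro cd_polys_diff cd_polys_add cd_polys_var_mult Suc)
  finally show ?case .
qed simp

text \<open>On even rank the coefficient \<open>l x y\<close> vanishes; on odd rank the exponent,
  being one less, is even.\<close>

lemma sym_step_mult_cd_polys:
  assumes "eulerian P \<rho> \<zeta>" "x \<in> P" "y \<in> P" "x < y" "p \<in> cd_polys"
  shows "sym_step x y * p \<in> cd_polys"
proof (cases "even (rank_diff \<rho> x y)")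
  case True
  then have "sym_step x y * p = nc_const 0 * p"
    using assms sym_zeta_even_rank by (simp add: sym_step_def)
  then show ?thesis using cd_polys_const_mult[OF assms(5), of 0] by simp
next
  case False
  then obtain m where "rank_diff \<rho> x y - 1 = 2 * m"
    by (elim oddE) simp
  then show ?thesis
    using assms(5)
    by (simp add: sym_step_def mult.assoc cd_polys_const_mult cd_polys_even_power_mult)
qed

lemma ab_index_in_cd_polys:
  assumes "eulerian P \<rho> \<zeta>" "x \<in> P" "z \<in> P" "x < z"
  shows "\<Psi> x z \<in> cd_polys"
  using \<open>x \<in> P\<close> \<open>x < z\<close>
proof (induction "\<rho> z - \<rho> x" arbitrary: x rule: less_induct)
  case less
  \<comment> \<open>Writing the leading term as \<open>sym_step x z * 1\<close> lets the
    multiplication lemma cover it too.\<close>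
  have "1 \<in> cd_polys"
    using nc_subst_1 by (metis rangeI)
  then have "sym_step x z * 1 \<in> cd_polys"
    by (intro sym_step_mult_cd_polys) (use assms less.prems in auto)
  moreover have "sym_step x y * (nc_const (1 / 2) * (a_poly + b_poly) * \<Psi> y z) \<in> cd_polys"
    if y: "y \<in> P" "x < y" "y < z" for y
  proof -
    have "\<Psi> y z \<in> cd_polys"
      using less y rank_mono[of x y] rank_mono[of y z] assms(3) by auto
    from cd_polys_const_mult[OF cd_polys_var_mult[OF this, of C]] show ?thesis
      by (intro sym_step_mult_cd_polys) (use assms less.prems y in \<open>auto simp: mult.assoc\<close>)
  qed
  ultimately show ?case
    unfolding ab_index_sym_rec[OF less.prems(1) assms(3) less.prems(2)] conv_def
    by (intro cd_polys_add cd_polys_sum) auto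
qed

text \<open>The induction follows the recursion through \<open>chain_step\<close>, whose
  coefficients are values of \<open>\<zeta>\<close>, because the one through \<open>sym_step\<close>
  contains halves.\<close>

lemma int_coeffs_ab_index:
  assumes int: "\<forall>x\<in>P. \<forall>y\<in>P. x \<le> y \<longrightarrow> \<zeta> x y \<in> \<int>" and "x \<in> P" "z \<in> P" "x < z"
  shows "int_coeffs (\<Psi> x z)"
  using \<open>x \<in> P\<close> \<open>x < z\<close>
proof (induction "\<rho> z - \<rho> x" arbitrary: x rule: less_induct)
  case less
  have step: "int_coeffs (chain_step x y)" if "y \<in> P" "x < y" for y
    unfolding chain_step_def using int that less.prems
    by (intro int_coeffs_mult int_coeffs_const int_coeffs_power int_coeffs_diff int_coeffs_var)
      auto
  have rest: "int_coeffs (chain_step x y * (b_poly * \<Psi> y z))" if y: "y \<in> P" "x < y" "y < z" for y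
  proof -
    have "int_coeffs (\<Psi> y z)"
      using less y rank_mono[of x y] rank_mono[of y z] assms(3) by auto
    then show ?thesis
      by (intro int_coeffs_mult step int_coeffs_var y)
  qed
  have "int_coeffs (conv P chain_step (\<lambda>y z. b_poly * \<Psi> y z) x z)"
    unfolding conv_def by (rule int_coeffs_sum) (use rest in auto)
  with step[OF assms(3) less.prems(2)] show ?case
    unfolding ab_index_rec[OF less.prems(1) assms(3) less.prems(2)]
    by (simp add: int_coeffs_def lookup_add)
qed

end

theorem theorem4p2:
  fixes P :: "'p::order set"
    and \<rho> :: "'p \<Rightarrow> nat"
    and \<zeta> :: "'p \<Rightarrow> 'p \<Rightarrow> complex"
    and hat0 hat1 :: 'p
  assumes "quasi_graded P \<rho> \<zeta>"
    and "eulerian P \<rho> \<zeta>"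
    and "is_least P hat0"
    and "is_greatest P hat1"
    and "hat0 < hat1"
  shows "(\<exists>!\<Phi>. nc_subst cd_in_ab \<Phi> = ab_index P \<rho> \<zeta> hat0 hat1) \<and>
    ((\<forall>x\<in>P. \<forall>y\<in>P. x \<le> y \<longrightarrow> \<zeta> x y \<in> \<int>) \<longrightarrow>
      (\<forall>\<Phi>. nc_subst cd_in_ab \<Phi> = ab_index P \<rho> \<zeta> hat0 hat1 \<longrightarrow>
        (\<forall>w. Poly_Mapping.lookup \<Phi> w \<in> \<int>)))"
proof -
  interpret quasi_graded_poset P \<rho> \<zeta>
    by unfold_locales (fact assms(1))
  have ends: "hat0 \<in> P" "hat1 \<in> P"
    using assms by (auto simp: is_least_def is_greatest_def)
  obtain \<Phi> where \<Phi>: "nc_subst cd_in_ab \<Phi> = ab_index P \<rho> \<zeta> hat0 hat1"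
    using ab_index_in_cd_polys[OF assms(2) ends assms(5)] by (metis imageE)
  have "\<exists>!\<Phi>. nc_subst cd_in_ab \<Phi> = ab_index P \<rho> \<zeta> hat0 hat1"
    using \<Phi> nc_subst_cd_inj by (intro ex1I[of _ \<Phi>]) auto
  moreover have "Poly_Mapping.lookup \<Phi>' w \<in> \<int>"
    if int: "\<forall>x\<in>P. \<forall>y\<in>P. x \<le> y \<longrightarrow> \<zeta> x y \<in> \<int>"
      and \<Phi>': "nc_subst cd_in_ab \<Phi>' = ab_index P \<rho> \<zeta> hat0 hat1" for \<Phi>' w
    by (rule cd_lookup_in_subgroup)
      (use int_coeffs_ab_index[OF int ends assms(5)] in \<open>auto simp: \<Phi>' int_coeffs_def\<close>)
  ultimately show ?thesis by blast
qed

end
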